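(* For any integer $n>1$, $$|AMT(1,n)|=\sum_{\alpha\in AMT(1,n-1)}\big|[\emptyset,\alpha]\big|.$$
   Context: For a finite set $N$ of positive integers, an antimonotonic function on $2^N$ is a boolean function on $2^N$, identified with the set $\alpha$ of subsets of $N$ on which it is true, such that no element of $\alpha$ is a proper subset of another element of $\alpha$. $AMT(N)$ is the set of all of them (both $\emptyset$ and $\{\emptyset\}$ belong to it); $AMT(1,m)$ denotes $AMT(\{1,\dots,m\})$. Order: $\alpha\le\beta$ iff every $A\in\alpha$ is contained in some $B\in\beta$. The interval $[\alpha,\beta]$ is the set of antimonotonic functions $\kappa$ with $\alpha\le\kappa\le\beta$. Here $[\emptyset,\alpha]$ has as lower end the empty antimonotonic function $\emptyset$, the least element for $\le$. *)

theory Defs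
  imports Main
begin

text \<open>A boolean function on \<open>2^N\<close> is identified with the set of subsets of \<open>N\<close> on which it is
  true.\<close>

definition AMT :: "nat set \<Rightarrow> nat set set set" where
  "AMT N = {\<alpha>. \<alpha> \<subseteq> Pow N \<and> (\<forall>A\<in>\<alpha>. \<forall>B\<in>\<alpha>. \<not> A \<subset> B)}"

text \<open>This order is not the inclusion order on sets of sets.\<close>

definition amt_le :: "nat set set \<Rightarrow> nat set set \<Rightarrow> bool" (infix "\<preceq>" 50) where
  "\<alpha> \<preceq> \<beta> \<longleftrightarrow> (\<forall>A\<in>\<alpha>. \<exists>B\<in>\<beta>. A \<subseteq> B)"

text \<open>The interval from \<open>\<alpha>\<close> to \<open>\<beta>\<close> in \<open>AMT N\<close>. Since \<open>\<kappa> \<preceq> \<beta>\<close> forces \<open>\<Union>\<kappa> \<subseteq> \<Union>\<beta>\<close>, it does not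
  depend on the choice of a ground set \<open>N\<close> with \<open>\<beta> \<in> AMT N\<close>.\<close>

definition amt_interval :: "nat set \<Rightarrow> nat set set \<Rightarrow> nat set set \<Rightarrow> nat set set set" where
  "amt_interval N \<alpha> \<beta> = {\<kappa> \<in> AMT N. \<alpha> \<preceq> \<kappa> \<and> \<kappa> \<preceq> \<beta>}"

end

theory Submission
  imports Defs
begin

text \<open>Antimonotonic functions on \<open>2^N\<close> are the same thing as down-sets of \<open>2^N\<close>, an antichain being
  the set of maximal members of its down-set. A down-set over \<open>insert x N\<close> amounts to a pair of
  nested down-sets over \<open>N\<close>: the larger one consists of its members that avoid \<open>x\<close>, the smaller one
  of the \<open>K\<close> for which \<open>insert x K\<close> is a member. In terms of maximal members, nested pairs of
  down-sets are the pairs \<open>(\<alpha>, \<kappa>)\<close> with \<open>\<kappa> \<preceq> \<alpha>\<close>, and each \<open>\<alpha>\<close> has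
  as many such partners as the interval from \<open>{}\<close> to \<open>\<alpha>\<close> has elements.

  The proof writes this correspondence directly on antichains: \<open>glue x\<close> sends a pair to the
  antichain over \<open>insert x N\<close>, and \<open>trace x\<close> and \<open>link x\<close> recover the two components. Lemmas
  \<open>trace_glue\<close>, \<open>link_glue\<close> and \<open>glue_trace_link\<close> say that these are mutually inverse.\<close>

text \<open>These are the maximal members of \<open>\<alpha> \<union> insert x ` \<kappa>\<close>: when \<open>\<kappa> \<preceq> \<alpha>\<close>, a set \<open>A \<in> \<alpha>\<close> lies
  below some \<open>insert x K\<close> with \<open>K \<in> \<kappa>\<close> only if it is itself in \<open>\<kappa>\<close>.\<close>

definition glue :: "nat \<Rightarrow> nat set set \<Rightarrow> nat set set \<Rightarrow> nat set set" where
  "glue x \<alpha> \<kappa> = (\<alpha> - \<kappa>) \<union> insert x ` \<kappa>"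

definition link :: "nat \<Rightarrow> nat set set \<Rightarrow> nat set set" where
  "link x \<gamma> = {K. x \<notin> K \<and> insert x K \<in> \<gamma>}"

text \<open>Among the sets avoiding \<open>x\<close> that lie below a member of an antichain \<open>\<gamma>\<close>, these are the maximal
  ones. Such a set lies below a member avoiding \<open>x\<close> or below a set in the link, but a link set may
  fail to be maximal by lying below a member avoiding \<open>x\<close>.\<close>

definition trace :: "nat \<Rightarrow> nat set set \<Rightarrow> nat set set" where
  "trace x \<gamma> = {A \<in> \<gamma>. x \<notin> A} \<union> {K \<in> link x \<gamma>. \<forall>A\<in>\<gamma>. x \<notin> A \<longrightarrow> \<not> K \<subseteq> A}"

lemma AMT_subset: "\<lbrakk>\<alpha> \<in> AMT N; A \<in> \<alpha>\<rbrakk> \<Longrightarrow> A \<subseteq> N"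
  by (auto simp: AMT_def)

lemma AMT_antichain: "\<lbrakk>\<alpha> \<in> AMT N; A \<in> \<alpha>; B \<in> \<alpha>; A \<subseteq> B\<rbrakk> \<Longrightarrow> A = B"
  unfolding AMT_def by blast

lemma AMT_I:
  assumes "\<And>A. A \<in> \<alpha> \<Longrightarrow> A \<subseteq> N"
    and "\<And>A B. \<lbrakk>A \<in> \<alpha>; B \<in> \<alpha>; A \<subseteq> B\<rbrakk> \<Longrightarrow> A = B"
  shows "\<alpha> \<in> AMT N"
  using assms unfolding AMT_def by blast

lemma finite_AMT: "finite N \<Longrightarrow> finite (AMT N)"
  by (rule finite_subset[of _ "Pow (Pow N)"]) (auto simp: AMT_def)

lemma amt_interval_empty: "amt_interval N {} \<alpha> = {\<kappa> \<in> AMT N. \<kappa> \<preceq> \<alpha>}"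
  by (auto simp: amt_interval_def amt_le_def)

lemma glue_in_AMT:
  assumes x: "x \<notin> N" and a: "\<alpha> \<in> AMT N" and k: "\<kappa> \<in> AMT N" and le: "\<kappa> \<preceq> \<alpha>"
  shows "glue x \<alpha> \<kappa> \<in> AMT (insert x N)"
proof (rule AMT_I)
  fix A assume "A \<in> glue x \<alpha> \<kappa>"
  then show "A \<subseteq> insert x N"
    using AMT_subset[OF a] AMT_subset[OF k] by (auto simp: glue_def)
next
  fix A B assume A: "A \<in> glue x \<alpha> \<kappa>" and B: "B \<in> glue x \<alpha> \<kappa>" and AB: "A \<subseteq> B"
  have x_alpha: "x \<notin> C" if "C \<in> \<alpha>" for C using AMT_subset[OF a that] x by blast
  have x_kappa: "x \<notin> C" if "C \<in> \<kappa>" for C using AMT_subset[OF k that] x by blast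
  consider (old) "A \<in> \<alpha>" "A \<notin> \<kappa>" | (new) K where "K \<in> \<kappa>" "A = insert x K"
    using A by (auto simp: glue_def)
  then show "A = B"
  proof cases
    case old
    have "B \<in> \<alpha>"
    proof (rule ccontr)
      assume "B \<notin> \<alpha>"
      then obtain L where L: "L \<in> \<kappa>" "B = insert x L" using B by (auto simp: glue_def)
      \<comment> \<open>\<open>L\<close> is squeezed between the members \<open>A\<close> and \<open>C\<close> of \<open>\<alpha>\<close>, so \<open>A\<close> would be in \<open>\<kappa>\<close>.\<close>
      have "A \<subseteq> L" using AB L x_alpha[OF old(1)] by blast
      moreover obtain C where C: "C \<in> \<alpha>" "L \<subseteq> C" using le L by (auto simp: amt_le_def)
      ultimately have "A = C" using AMT_antichain[OF a old(1)] by blast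
      then show False using \<open>A \<subseteq> L\<close> C L old(2) by auto
    qed
    then show ?thesis using AMT_antichain[OF a old(1)] AB by blast
  next
    case new
    then have "x \<in> B" using AB by blast
    then obtain L where L: "L \<in> \<kappa>" "B = insert x L"
      using B x_alpha by (auto simp: glue_def)
    have "K \<subseteq> L" using AB L new x_kappa by blast
    then show ?thesis using AMT_antichain[OF k] new L by blast
  qed
qed

lemma link_in_AMT:
  assumes g: "\<gamma> \<in> AMT (insert x N)"
  shows "link x \<gamma> \<in> AMT N"
proof (rule AMT_I)
  fix A assume "A \<in> link x \<gamma>"
  then show "A \<subseteq> N" using AMT_subset[OF g, of "insert x A"] by (auto simp: link_def)
next
  fix A B assume "A \<in> link x \<gamma>" "B \<in> link x \<gamma>" "A \<subseteq> B"
  then have "x \<notin> A" "x \<notin> B" "insert x A = insert x B"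
    using AMT_antichain[OF g, of "insert x A" "insert x B"] by (auto simp: link_def)
  then show "A = B" by (simp add: insert_ident)
qed

lemma trace_in_AMT:
  assumes g: "\<gamma> \<in> AMT (insert x N)"
  shows "trace x \<gamma> \<in> AMT N"
proof (rule AMT_I)
  fix A assume "A \<in> trace x \<gamma>"
  then show "A \<subseteq> N"
    using AMT_subset[OF g, of A] AMT_subset[OF link_in_AMT[OF g], of A]
    by (auto simp: trace_def)
next
  fix A B assume A: "A \<in> trace x \<gamma>" and B: "B \<in> trace x \<gamma>" and AB: "A \<subseteq> B"
  show "A = B"
  proof (cases "A \<in> \<gamma>")
    case True
    have "B \<in> \<gamma>"
    proof (rule ccontr)
      assume "B \<notin> \<gamma>"
      then have L: "insert x B \<in> \<gamma>" using B by (auto simp: trace_def link_def)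
      have "A = insert x B" using AMT_antichain[OF g True L] AB by blast
      then show False using AB \<open>B \<notin> \<gamma>\<close> True by (auto simp: insert_absorb)
    qed
    then show ?thesis using AMT_antichain[OF g True] AB by blast
  next
    case False
    then have "A \<in> link x \<gamma>" "B \<in> link x \<gamma>" using A B AB by (auto simp: trace_def)
    then show ?thesis using AMT_antichain[OF link_in_AMT[OF g]] AB by blast
  qed
qed

lemma link_le_trace: "link x \<gamma> \<preceq> trace x \<gamma>"
  unfolding amt_le_def trace_def by blast

lemma link_glue:
  assumes x: "x \<notin> N" and a: "\<alpha> \<in> AMT N" and k: "\<kappa> \<in> AMT N"
  shows "link x (glue x \<alpha> \<kappa>) = \<kappa>"
proof -
  have avoid: "x \<notin> C" if "C \<in> \<alpha> \<union> \<kappa>" for C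
    using that AMT_subset[OF a] AMT_subset[OF k] x by blast
  show ?thesis
  proof
    show "link x (glue x \<alpha> \<kappa>) \<subseteq> \<kappa>"
    proof
      fix K assume "K \<in> link x (glue x \<alpha> \<kappa>)"
      then have K: "x \<notin> K" "insert x K \<in> glue x \<alpha> \<kappa>" by (simp_all add: link_def)
      then obtain L where L: "L \<in> \<kappa>" "insert x K = insert x L"
        using avoid by (auto simp: glue_def)
      then have "K = L" using K(1) avoid by (simp add: insert_ident)
      then show "K \<in> \<kappa>" using L(1) by simp
    qed
    show "\<kappa> \<subseteq> link x (glue x \<alpha> \<kappa>)"
      using avoid by (auto simp: link_def glue_def)
  qed
qed

text \<open>The members of \<open>\<alpha> - \<kappa>\<close> are visible in \<open>glue x \<alpha> \<kappa>\<close> as its members avoiding \<open>x\<close>, but those of \<open>\<alpha> \<inter> \<kappa>\<close> have to be told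
  apart from the rest of \<open>\<kappa>\<close>. By \<open>\<kappa> \<preceq> \<alpha>\<close>, some \<open>A \<in> \<alpha>\<close> contains a given \<open>K \<in> \<kappa> - \<alpha>\<close>; this \<open>A\<close> is
  not in the antichain \<open>\<kappa>\<close>, so it is visible. No visible set contains a member of \<open>\<alpha> \<inter> \<kappa>\<close>, because
  \<open>\<alpha>\<close> is an antichain.\<close>

lemma trace_glue:
  assumes x: "x \<notin> N" and a: "\<alpha> \<in> AMT N" and k: "\<kappa> \<in> AMT N" and le: "\<kappa> \<preceq> \<alpha>"
  shows "trace x (glue x \<alpha> \<kappa>) = \<alpha>"
proof -
  have "x \<notin> C" if "C \<in> \<alpha>" for C
    using that AMT_subset[OF a] x by blast
  then have old: "A \<in> glue x \<alpha> \<kappa> \<and> x \<notin> A \<longleftrightarrow> A \<in> \<alpha> - \<kappa>" for A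
    by (auto simp: glue_def)
  have "K \<in> \<alpha> \<longleftrightarrow> (\<forall>A\<in>\<alpha> - \<kappa>. \<not> K \<subseteq> A)" if K: "K \<in> \<kappa>" for K
  proof
    assume "K \<in> \<alpha>"
    then show "\<forall>A\<in>\<alpha> - \<kappa>. \<not> K \<subseteq> A" using AMT_antichain[OF a] K by blast
  next
    assume none: "\<forall>A\<in>\<alpha> - \<kappa>. \<not> K \<subseteq> A"
    obtain A where A: "A \<in> \<alpha>" "K \<subseteq> A" using le K by (auto simp: amt_le_def)
    then have "A \<in> \<kappa>" using none by blast
    then show "K \<in> \<alpha>" using AMT_antichain[OF k K] A by blast
  qed
  moreover have "trace x (glue x \<alpha> \<kappa>) = (\<alpha> - \<kappa>) \<union> {K \<in> \<kappa>. \<forall>A\<in>\<alpha> - \<kappa>. \<not> K \<subseteq> A}"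
    unfolding trace_def link_glue[OF x a k] using old by blast
  ultimately have "trace x (glue x \<alpha> \<kappa>) = (\<alpha> - \<kappa>) \<union> {K \<in> \<kappa>. K \<in> \<alpha>}" by auto
  then show ?thesis by blast
qed

text \<open>An antichain cannot contain both \<open>A\<close> and \<open>insert x A\<close> when \<open>x \<notin> A\<close>. Hence removing the link
  from the trace leaves exactly the members of \<open>\<gamma>\<close> that avoid \<open>x\<close>, and the others come from the
  link.\<close>

lemma glue_trace_link:
  assumes g: "\<gamma> \<in> AMT N"
  shows "glue x (trace x \<gamma>) (link x \<gamma>) = \<gamma>"
proof -
  have "A \<notin> link x \<gamma>" if "A \<in> \<gamma>" for A
    using AMT_antichain[OF g that, of "insert x A"] by (auto simp: link_def)
  then have "trace x \<gamma> - link x \<gamma> = {A \<in> \<gamma>. x \<notin> A}"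
    by (auto simp: trace_def)
  moreover have "insert x ` link x \<gamma> = {A \<in> \<gamma>. x \<in> A}"
  proof
    show "insert x ` link x \<gamma> \<subseteq> {A \<in> \<gamma>. x \<in> A}" by (auto simp: link_def)
    show "{A \<in> \<gamma>. x \<in> A} \<subseteq> insert x ` link x \<gamma>"
    proof
      fix A assume "A \<in> {A \<in> \<gamma>. x \<in> A}"
      then have "A = insert x (A - {x})" "A - {x} \<in> link x \<gamma>"
        by (auto simp: link_def insert_absorb)
      then show "A \<in> insert x ` link x \<gamma>" by (rule image_eqI)
    qed
  qed
  ultimately show ?thesis by (auto simp: glue_def)
qed

lemma card_AMT_insert:
  assumes "finite N" and x: "x \<notin> N"
  shows "card (AMT (insert x N)) = (\<Sum>\<alpha>\<in>AMT N. card (amt_interval N {} \<alpha>))"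
proof -
  let ?P = "SIGMA \<alpha>:AMT N. amt_interval N {} \<alpha>"
  have "bij_betw (\<lambda>(\<alpha>, \<kappa>). glue x \<alpha> \<kappa>) ?P (AMT (insert x N))"
    by (rule bij_betw_byWitness[where f' = "\<lambda>\<gamma>. (trace x \<gamma>, link x \<gamma>)"])
      (auto simp: amt_interval_empty trace_glue[OF x] link_glue[OF x] glue_trace_link
        glue_in_AMT[OF x] trace_in_AMT link_in_AMT link_le_trace)
  then have "card (AMT (insert x N)) = card ?P"
    by (simp add: bij_betw_same_card)
  also have "\<dots> = (\<Sum>\<alpha>\<in>AMT N. card (amt_interval N {} \<alpha>))"
    by (rule card_SigmaI) (simp_all add: finite_AMT \<open>finite N\<close> amt_interval_empty)
  finally show ?thesis .
qed

theorem corollary7: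
  fixes n :: nat
  assumes "n > 1"
  shows "card (AMT {1..n}) = (\<Sum>\<alpha>\<in>AMT {1..n-1}. card (amt_interval {1..n-1} {} \<alpha>))"
proof -
  have "{1..n} = insert n {1..n-1}" using assms by auto
  moreover have "n \<notin> {1..n-1}" using assms by auto
  ultimately show ?thesis using card_AMT_insert[of "{1..n-1}" n] by simp
qed

end
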